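(* Every torsion-free abelian group can be equipped with a compatible threshold order which is not total.
   Context: A partial order on a group is compatible if it is preserved by all translations. For an order $\leq$ on $X$ with strict order $<$, $x\leq_{pred}y$ means that for all $z\in X$, $z<x$ implies $z<y$, and $x\leq_{succ}y$ means that for all $z\in X$, $y<z$ implies $x<z$. An order is a threshold order if $\leq_{pred}$ and $\leq_{succ}$ are total orders and are equal.
   Formalization: The group is assumed nontrivial: the trivial group is torsion-free and abelian, but its only partial order is total, so the claim fails there. *)

theory Defs
  imports "HOL-Algebra.Algebra"
begin

text \<open>Orders are reflexive relations in the sense of \<^const>\<open>partial_order_on\<close>; the strict part
  of \<open>r\<close> is \<open>r - Id\<close>.\<close>

definition pred_rel :: "'a set \<Rightarrow> 'a rel \<Rightarrow> 'a rel" where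
  "pred_rel A r = {(x, y). x \<in> A \<and> y \<in> A \<and> (\<forall>z\<in>A. (z, x) \<in> r - Id \<longrightarrow> (z, y) \<in> r - Id)}"

definition succ_rel :: "'a set \<Rightarrow> 'a rel \<Rightarrow> 'a rel" where
  "succ_rel A r = {(x, y). x \<in> A \<and> y \<in> A \<and> (\<forall>z\<in>A. (y, z) \<in> r - Id \<longrightarrow> (x, z) \<in> r - Id)}"

text \<open>In general \<^const>\<open>pred_rel\<close> and \<^const>\<open>succ_rel\<close> are only preorders; a threshold order
  requires them to be total orders, antisymmetry included.\<close>

definition threshold_order_on :: "'a set \<Rightarrow> 'a rel \<Rightarrow> bool" where
  "threshold_order_on A r \<longleftrightarrow>
     partial_order_on A r \<and>
     linear_order_on A (pred_rel A r) \<and>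
     linear_order_on A (succ_rel A r) \<and>
     pred_rel A r = succ_rel A r"

definition compatible_order :: "('a, 'b) monoid_scheme \<Rightarrow> 'a rel \<Rightarrow> bool" where
  "compatible_order G r \<longleftrightarrow>
     partial_order_on (carrier G) r \<and>
     (\<forall>x\<in>carrier G. \<forall>y\<in>carrier G. \<forall>z\<in>carrier G. (x, y) \<in> r \<longrightarrow>
        (z \<otimes>\<^bsub>G\<^esub> x, z \<otimes>\<^bsub>G\<^esub> y) \<in> r \<and> (x \<otimes>\<^bsub>G\<^esub> z, y \<otimes>\<^bsub>G\<^esub> z) \<in> r)"

definition torsion_free :: "('a, 'b) monoid_scheme \<Rightarrow> bool" where
  "torsion_free G \<longleftrightarrow>
     (\<forall>x\<in>carrier G. \<forall>n::nat. 0 < n \<longrightarrow> x [^]\<^bsub>G\<^esub> n = \<one>\<^bsub>G\<^esub> \<longrightarrow> x = \<one>\<^bsub>G\<^esub>)"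

text \<open>The trivial group is torsion-free, but its only order is total; it has to be excluded
  whenever a compatible order that is not total is asked for.\<close>

lemma trivial_group_order_total:
  assumes "trivial_group G" and "partial_order_on (carrier G) r"
  shows "linear_order_on (carrier G) r"
  using assms by (auto simp: trivial_group_def linear_order_on_def total_on_def)

end

theory Submission
  imports Defs
begin

text \<open>
  A torsion-free abelian group carries a compatible linear order \<open>L\<close>.  The relation ``\<open>x = y\<close> or
  \<open>c \<otimes> x\<close> is \<open>L\<close>-below \<open>y\<close>'', for a fixed \<open>c\<close> that is strictly \<open>L\<close>-above \<open>\<one>\<close>, is
  then a compatible order (a semiorder with unit \<open>c\<close>).  Its strict down-set at \<open>x\<close> is the \<open>L\<close>-down-set of \<open>inv c \<otimes> x\<close> and its strict up-set is the \<open>L\<close>-up-set of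
  \<open>c \<otimes> x\<close>; as translations preserve \<open>L\<close>, inclusion of either kind of set recovers \<open>L\<close> itself, so
  both derived orders equal \<open>L\<close> (lemma \<open>shift_order_threshold\<close>).  With \<open>c = e \<otimes> e\<close> for some \<open>e\<close>
  strictly above \<open>\<one>\<close>, the elements \<open>\<one>\<close> and \<open>e\<close> are closer than one unit, hence incomparable.

  The linear order comes from a maximal positive cone, which Zorn's lemma provides (lemma
  \<open>maximal_positive_cone\<close>).  Adjoining an element \<open>x\<close> to a cone \<open>P\<close> can only fail if
  some positive power of \<open>inv x\<close> lies in \<open>P\<close>.  If neither \<open>x\<close> nor \<open>inv x\<close> were in a maximal
  \<open>P\<close>, then \<open>P\<close> would contain positive powers of both, hence a power of \<open>x\<close> together with its
  inverse.  This power would be \<open>\<one>\<close>, so \<open>x = \<one>\<close> by torsion-freeness, although \<open>\<one>\<close> is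
  in \<open>P\<close>.
\<close>

section \<open>Maximal positive cones and linear orders\<close>

context comm_group
begin

text \<open>In an abelian group these are exactly the sets of elements above \<open>\<one>\<close> in some compatible
  partial order.\<close>

definition positive_cone :: "'a set \<Rightarrow> bool" where
  "positive_cone P \<longleftrightarrow> P \<subseteq> carrier G \<and> \<one> \<in> P \<and>
     (\<forall>x\<in>P. \<forall>y\<in>P. x \<otimes> y \<in> P) \<and> (\<forall>x\<in>P. inv x \<in> P \<longrightarrow> x = \<one>)"

lemma positive_cone_pow_closed:
  assumes "positive_cone P" and "x \<in> P"
  shows "x [^] (n::nat) \<in> P"
  using assms by (induction n) (auto simp: positive_cone_def)

lemma maximal_positive_cone:
  obtains P where "positive_cone P"
    and "\<forall>Q. positive_cone Q \<longrightarrow> P \<subseteq> Q \<longrightarrow> Q = P"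
proof -
  have "\<exists>P\<in>Collect positive_cone. \<forall>Q\<in>Collect positive_cone. P \<subseteq> Q \<longrightarrow> Q = P"
  proof (rule subset_Zorn_nonempty)
    have "positive_cone {\<one>}" by (auto simp: positive_cone_def)
    then show "Collect positive_cone \<noteq> {}" by blast
  next
    fix C assume ne: "C \<noteq> {}" and chain: "subset.chain (Collect positive_cone) C"
    have cone: "positive_cone P" if "P \<in> C" for P
      using chain that by (auto simp: subset_chain_def)
    \<comment> \<open>Both closure conditions speak of two elements, and two elements of the union of a chain
      lie in a common member.\<close>
    have common: "\<exists>P\<in>C. x \<in> P \<and> y \<in> P" if "x \<in> \<Union>C" "y \<in> \<Union>C" for x y
      using chain that unfolding subset_chain_def by blast
    have "x \<otimes> y \<in> \<Union>C" if "x \<in> \<Union>C" "y \<in> \<Union>C" for x y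
      using common[OF that] cone by (meson UnionI positive_cone_def)
    moreover have "x = \<one>" if "x \<in> \<Union>C" "inv x \<in> \<Union>C" for x
      using common[OF that] cone by (meson positive_cone_def)
    moreover have "\<Union>C \<subseteq> carrier G"
      using cone unfolding positive_cone_def by blast
    moreover have "\<one> \<in> \<Union>C"
      using ne cone unfolding positive_cone_def by blast
    ultimately show "\<Union>C \<in> Collect positive_cone"
      unfolding mem_Collect_eq positive_cone_def by (intro conjI ballI impI)
  qed
  then show thesis using that by blast
qed

text \<open>The set of all products \<open>p \<otimes> x [^] n\<close> with \<open>p \<in> P\<close> is the submonoid generated by \<open>P\<close>
  and \<open>x\<close>.  As \<open>x \<notin> P\<close>, maximality forbids it to be a cone, and a nontrivial element whose inverse it also
  contains yields \<open>p \<otimes> q \<otimes> x [^] k = \<one>\<close>; here \<open>k > 0\<close> because \<open>P\<close> itself is a cone.\<close>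

lemma maximal_cone_inv_pow:
  assumes P: "positive_cone P"
    and max: "\<forall>Q. positive_cone Q \<longrightarrow> P \<subseteq> Q \<longrightarrow> Q = P"
    and x: "x \<in> carrier G" "x \<notin> P"
  obtains k :: nat where "0 < k" and "inv x [^] k \<in> P"
proof -
  define Q where "Q = {p \<otimes> x [^] n | p n::nat. p \<in> P}"
  have sub: "P \<subseteq> carrier G" and one: "\<one> \<in> P"
    and mult: "\<And>p q. p \<in> P \<Longrightarrow> q \<in> P \<Longrightarrow> p \<otimes> q \<in> P"
    and anti: "\<And>p. p \<in> P \<Longrightarrow> inv p \<in> P \<Longrightarrow> p = \<one>"
    using P by (auto simp: positive_cone_def)
  have carr: "p \<in> carrier G" if "p \<in> P" for p using sub that by blast
  have prod: "(p \<otimes> x [^] n) \<otimes> (q \<otimes> x [^] m) = (p \<otimes> q) \<otimes> x [^] (n + m)"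
    if "p \<in> P" "q \<in> P" for p q and n m :: nat
    using that x by (simp add: carr m_ac flip: nat_pow_mult)
  have "P \<subseteq> Q"
  proof
    fix p assume "p \<in> P"
    moreover from this have "p = p \<otimes> x [^] (0::nat)" by (simp add: carr)
    ultimately show "p \<in> Q" unfolding Q_def by blast
  qed
  moreover have "x \<in> Q"
  proof -
    have "x = \<one> \<otimes> x [^] (1::nat)" using x by simp
    then show ?thesis unfolding Q_def using one by blast
  qed
  ultimately have "\<not> positive_cone Q" using max x by blast
  moreover have "Q \<subseteq> carrier G" using x by (auto simp: Q_def carr)
  moreover have "y \<otimes> z \<in> Q" if "y \<in> Q" "z \<in> Q" for y z
    using that prod mult unfolding Q_def by blast
  ultimately obtain y where y: "y \<in> Q" "inv y \<in> Q" "y \<noteq> \<one>"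
    using \<open>P \<subseteq> Q\<close> one by (auto simp: positive_cone_def)
  then obtain p n q m where pq: "p \<in> P" "q \<in> P"
    and yp: "y = p \<otimes> x [^] (n::nat)" and yq: "inv y = q \<otimes> x [^] (m::nat)"
    unfolding Q_def by blast
  have "y \<otimes> inv y = \<one>" using y \<open>Q \<subseteq> carrier G\<close> by auto
  then have rel: "(p \<otimes> q) \<otimes> x [^] (n + m) = \<one>"
    using prod[OF pq] yp yq by simp
  have "inv x [^] (n + m) = inv (x [^] (n + m))" using x by (simp add: nat_pow_inv)
  also have "\<dots> = p \<otimes> q"
    using rel x pq by (intro inv_equality) (auto simp: carr)
  finally have "inv x [^] (n + m) \<in> P" using mult pq by simp
  moreover have "0 < n + m"
  proof (rule ccontr)
    assume "\<not> 0 < n + m"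
    then have "y = p" "inv y = q" using yp yq pq by (auto simp: carr)
    then show False using anti y pq by blast
  qed
  ultimately show thesis by (rule that[rotated])
qed

lemma maximal_cone_total:
  assumes tf: "torsion_free G"
    and P: "positive_cone P"
    and max: "\<forall>Q. positive_cone Q \<longrightarrow> P \<subseteq> Q \<longrightarrow> Q = P"
    and x: "x \<in> carrier G"
  shows "x \<in> P \<or> inv x \<in> P"
proof (rule ccontr)
  assume "\<not> (x \<in> P \<or> inv x \<in> P)"
  then have notin: "x \<notin> P" "inv x \<notin> P" by auto
  obtain k :: nat where k: "0 < k" "inv x [^] k \<in> P"
    using maximal_cone_inv_pow[OF P max x notin(1)] by blast
  obtain l :: nat where l: "0 < l" "inv (inv x) [^] l \<in> P"
    using maximal_cone_inv_pow[OF P max inv_closed[OF x] notin(2)] by blast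
  have "x [^] (l * k) \<in> P"
    using positive_cone_pow_closed[OF P l(2), of k] x by (simp add: nat_pow_pow)
  moreover have "inv (x [^] (l * k)) \<in> P"
    using positive_cone_pow_closed[OF P k(2), of l] x
    by (simp add: nat_pow_pow nat_pow_inv mult.commute)
  ultimately have "x [^] (l * k) = \<one>" using P by (auto simp: positive_cone_def)
  then have "x = \<one>" using tf x k l unfolding torsion_free_def by (metis nat_0_less_mult_iff)
  then show False using P notin by (auto simp: positive_cone_def)
qed

theorem torsion_free_compatible_linear_order:
  assumes "torsion_free G"
  obtains L where "linear_order_on (carrier G) L" and "compatible_order G L"
proof -
  obtain P where P: "positive_cone P"
    and max: "\<forall>Q. positive_cone Q \<longrightarrow> P \<subseteq> Q \<longrightarrow> Q = P"
    using maximal_positive_cone by blast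
  define L where "L = {(x, y). x \<in> carrier G \<and> y \<in> carrier G \<and> inv x \<otimes> y \<in> P}"
  have "refl_on (carrier G) L" "L \<subseteq> carrier G \<times> carrier G"
    using P by (auto simp: refl_on_def L_def positive_cone_def)
  moreover have "trans L"
  proof (rule transI)
    fix x y z assume xy: "(x, y) \<in> L" and yz: "(y, z) \<in> L"
    then have carr: "x \<in> carrier G" "y \<in> carrier G" "z \<in> carrier G" by (auto simp: L_def)
    have "(inv x \<otimes> y) \<otimes> (inv y \<otimes> z) = inv x \<otimes> (y \<otimes> inv y) \<otimes> z"
      using carr by (simp only: m_assoc m_closed inv_closed)
    also have "\<dots> = inv x \<otimes> z" using carr by simp
    finally have "inv x \<otimes> z = (inv x \<otimes> y) \<otimes> (inv y \<otimes> z)" by (rule sym)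
    then have "inv x \<otimes> z \<in> P"
      using xy yz P unfolding L_def positive_cone_def by auto
    then show "(x, z) \<in> L"
      using carr by (simp add: L_def)
  qed
  moreover have "antisym L"
  proof (rule antisymI)
    fix x y assume xy: "(x, y) \<in> L" and yx: "(y, x) \<in> L"
    then have carr: "x \<in> carrier G" "y \<in> carrier G" by (auto simp: L_def)
    have "inv (inv x \<otimes> y) = inv y \<otimes> x" using carr by (simp add: inv_mult_group)
    then have "inv x \<otimes> y = \<one>" using xy yx P by (auto simp: L_def positive_cone_def)
    then have "inv y = inv x" using carr by (simp add: inv_equality)
    then have "inv (inv x) = inv (inv y)" by simp
    then show "x = y" using carr by simp
  qed
  moreover have "total_on (carrier G) L"
  proof (rule total_onI)
    fix x y assume carr: "x \<in> carrier G" "y \<in> carrier G"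
    have "inv (inv x \<otimes> y) = inv y \<otimes> x" using carr by (simp add: inv_mult_group)
    then show "(x, y) \<in> L \<or> (y, x) \<in> L"
      using maximal_cone_total[OF assms P max, of "inv x \<otimes> y"] carr by (auto simp: L_def)
  qed
  ultimately have lin: "linear_order_on (carrier G) L"
    by (simp add: linear_order_on_def partial_order_on_def preorder_on_def)
  have "(z \<otimes> x, z \<otimes> y) \<in> L"
    if "(x, y) \<in> L" "z \<in> carrier G" for x y z
  proof -
    have carr: "x \<in> carrier G" "y \<in> carrier G" using that by (auto simp: L_def)
    have "inv (z \<otimes> x) \<otimes> (z \<otimes> y) = inv x \<otimes> (inv z \<otimes> z) \<otimes> y"
      using carr that(2) by (simp only: inv_mult_group m_assoc m_closed inv_closed)
    also have "\<dots> = inv x \<otimes> y" using carr that(2) by simp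
    finally show ?thesis using that carr by (simp add: L_def)
  qed
  then have "(z \<otimes> x, z \<otimes> y) \<in> L \<and> (x \<otimes> z, y \<otimes> z) \<in> L"
    if "(x, y) \<in> L" "x \<in> carrier G" "y \<in> carrier G" "z \<in> carrier G" for x y z
    using that by (simp add: m_comm[of _ z])
  then have "compatible_order G L"
    using lin by (simp add: compatible_order_def linear_order_on_def)
  with lin show thesis using that by blast
qed

section \<open>Semiorders from a linear order and a unit\<close>

text \<open>In additive notation, and for positive \<open>c\<close>: strictly above \<open>x\<close> are exactly the elements
  that exceed \<open>x\<close> by at least \<open>c\<close>.\<close>

definition shift_order :: "'a rel \<Rightarrow> 'a \<Rightarrow> 'a rel" where
  "shift_order L c = {(x, y). x \<in> carrier G \<and> y \<in> carrier G \<and> (x = y \<or> (c \<otimes> x, y) \<in> L)}"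

context
  fixes L c
  assumes lin: "linear_order_on (carrier G) L"
    and comp: "compatible_order G L"
    and c: "(\<one>, c) \<in> L" "c \<noteq> \<one>"
begin

lemma L_carrier: "(x, y) \<in> L \<Longrightarrow> x \<in> carrier G \<and> y \<in> carrier G"
  using lin by (auto simp: linear_order_on_def partial_order_on_def preorder_on_def)

lemma L_refl: "x \<in> carrier G \<Longrightarrow> (x, x) \<in> L"
  using lin by (auto simp: linear_order_on_def partial_order_on_def preorder_on_def refl_on_def)

lemma L_trans: "(x, y) \<in> L \<Longrightarrow> (y, z) \<in> L \<Longrightarrow> (x, z) \<in> L"
  using lin by (auto simp: linear_order_on_def partial_order_on_def preorder_on_def dest: transD)

lemma L_antisym: "(x, y) \<in> L \<Longrightarrow> (y, x) \<in> L \<Longrightarrow> x = y"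
  using lin by (auto simp: linear_order_on_def partial_order_on_def dest: antisymD)

lemma c_carrier: "c \<in> carrier G"
  using L_carrier c by blast

lemma L_translate: "(x, y) \<in> L \<Longrightarrow> z \<in> carrier G \<Longrightarrow> (z \<otimes> x, z \<otimes> y) \<in> L"
  using comp by (auto simp: compatible_order_def dest: L_carrier)

lemma L_translate_iff:
  assumes "x \<in> carrier G" "y \<in> carrier G" "z \<in> carrier G"
  shows "(z \<otimes> x, z \<otimes> y) \<in> L \<longleftrightarrow> (x, y) \<in> L"
  using L_translate[of "z \<otimes> x" "z \<otimes> y" "inv z"] L_translate[of x y z] assms
  by (auto simp flip: m_assoc)

lemma L_shift_up: "x \<in> carrier G \<Longrightarrow> (x, c \<otimes> x) \<in> L"
  using L_translate[OF c(1), of x] c_carrier by (simp add: m_comm)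

lemma L_shift_irrefl: "(c \<otimes> x, x) \<notin> L"
proof
  assume "(c \<otimes> x, x) \<in> L"
  moreover from this have x: "x \<in> carrier G" using L_carrier by blast
  ultimately have "c \<otimes> x = x" by (intro L_antisym L_shift_up)
  then show False using x c c_carrier by simp
qed

lemma shift_order_strict:
  "(x, y) \<in> shift_order L c - Id \<longleftrightarrow> x \<in> carrier G \<and> (c \<otimes> x, y) \<in> L"
  using L_shift_irrefl by (auto simp: shift_order_def c_carrier dest: L_carrier)

lemma shift_order_partial: "partial_order_on (carrier G) (shift_order L c)"
proof -
  have step: "(x, y) \<in> L" if "x \<in> carrier G" "(c \<otimes> x, y) \<in> L" for x y
    using L_trans L_shift_up that by blast
  have "trans (shift_order L c)"
    unfolding trans_def shift_order_def using L_trans step by blast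
  moreover have "antisym (shift_order L c)"
    unfolding antisym_def shift_order_def using step L_antisym by blast
  ultimately show ?thesis
    by (auto simp: partial_order_on_def preorder_on_def refl_on_def shift_order_def)
qed

text \<open>Commutativity enters here: the left translation by \<open>z\<close> has to pass the factor \<open>c\<close>.\<close>

lemma shift_order_compatible: "compatible_order G (shift_order L c)"
proof -
  have left: "(z \<otimes> x, z \<otimes> y) \<in> shift_order L c"
    if "(x, y) \<in> shift_order L c" "z \<in> carrier G" for x y z
  proof -
    have carr: "x \<in> carrier G" "y \<in> carrier G" using that by (auto simp: shift_order_def)
    have "c \<otimes> (z \<otimes> x) = z \<otimes> (c \<otimes> x)" using carr that(2) c_carrier by (simp add: m_lcomm)
    then show ?thesis
      using that carr L_translate[of "c \<otimes> x" y z] by (auto simp: shift_order_def)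
  qed
  have "(x \<otimes> z, y \<otimes> z) \<in> shift_order L c"
    if "(x, y) \<in> shift_order L c" "x \<in> carrier G" "y \<in> carrier G" "z \<in> carrier G" for x y z
    using left[OF that(1,4)] that by (simp add: m_comm)
  then show ?thesis
    using shift_order_partial left by (simp add: compatible_order_def)
qed

lemma pred_rel_shift_order: "pred_rel (carrier G) (shift_order L c) = L"
proof -
  have "(\<forall>z\<in>carrier G. (c \<otimes> z, x) \<in> L \<longrightarrow> (c \<otimes> z, y) \<in> L) \<longleftrightarrow> (x, y) \<in> L"
    if xy: "x \<in> carrier G" "y \<in> carrier G" for x y
  proof
    assume sub: "\<forall>z\<in>carrier G. (c \<otimes> z, x) \<in> L \<longrightarrow> (c \<otimes> z, y) \<in> L"
    \<comment> \<open>The test element is the largest one below \<open>x\<close>, namely \<open>inv c \<otimes> x\<close>.\<close>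
    have "c \<otimes> (inv c \<otimes> x) = x" using xy c_carrier by (simp flip: m_assoc)
    then show "(x, y) \<in> L" using sub xy c_carrier L_refl by (metis inv_closed m_closed)
  next
    assume "(x, y) \<in> L"
    then show "\<forall>z\<in>carrier G. (c \<otimes> z, x) \<in> L \<longrightarrow> (c \<otimes> z, y) \<in> L"
      using L_trans by blast
  qed
  then show ?thesis
    unfolding pred_rel_def shift_order_strict by (auto dest: L_carrier)
qed

lemma succ_rel_shift_order: "succ_rel (carrier G) (shift_order L c) = L"
proof -
  have "(\<forall>z\<in>carrier G. (c \<otimes> y, z) \<in> L \<longrightarrow> (c \<otimes> x, z) \<in> L) \<longleftrightarrow> (x, y) \<in> L"
    if xy: "x \<in> carrier G" "y \<in> carrier G" for x y
  proof
    assume sub: "\<forall>z\<in>carrier G. (c \<otimes> y, z) \<in> L \<longrightarrow> (c \<otimes> x, z) \<in> L"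
    \<comment> \<open>The test element is the least one above \<open>y\<close>, namely \<open>c \<otimes> y\<close>.\<close>
    have "(c \<otimes> x, c \<otimes> y) \<in> L" using sub xy c_carrier L_refl by simp
    then show "(x, y) \<in> L" using xy c_carrier by (simp add: L_translate_iff)
  next
    assume "(x, y) \<in> L"
    then have "(c \<otimes> x, c \<otimes> y) \<in> L" using L_translate c_carrier by blast
    then show "\<forall>z\<in>carrier G. (c \<otimes> y, z) \<in> L \<longrightarrow> (c \<otimes> x, z) \<in> L"
      using L_trans by blast
  qed
  then show ?thesis
    unfolding succ_rel_def shift_order_strict by (auto dest: L_carrier)
qed

theorem shift_order_threshold: "threshold_order_on (carrier G) (shift_order L c)"
  using shift_order_partial pred_rel_shift_order succ_rel_shift_order lin
  by (simp add: threshold_order_on_def)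

text \<open>An element strictly between \<open>\<one>\<close> and \<open>c\<close> is incomparable to \<open>\<one>\<close>.\<close>

lemma shift_order_not_linear:
  assumes e: "(\<one>, e) \<in> L" "(e, c) \<in> L" "e \<noteq> \<one>" "e \<noteq> c"
  shows "\<not> linear_order_on (carrier G) (shift_order L c)"
proof -
  have carr: "e \<in> carrier G" using e L_carrier by blast
  have "(\<one>, e) \<notin> shift_order L c"
    using e c_carrier L_antisym by (auto simp: shift_order_def)
  moreover have "(e, \<one>) \<notin> shift_order L c"
  proof
    assume "(e, \<one>) \<in> shift_order L c"
    then have "(c \<otimes> e, \<one>) \<in> L" using e by (auto simp: shift_order_def)
    then have "(e, \<one>) \<in> L" by (rule L_trans[OF L_shift_up[OF carr]])
    then show False using e L_antisym by blast
  qed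
  ultimately show ?thesis
    using e carr by (auto simp: linear_order_on_def total_on_def)
qed

end

end

section \<open>A threshold order that is not total\<close>

theorem corollary12:
  fixes G :: "('a, 'b) monoid_scheme"
  assumes "comm_group G"
    and "torsion_free G"
    and "\<not> trivial_group G"
  shows "\<exists>r. compatible_order G r \<and> threshold_order_on (carrier G) r \<and>
             \<not> linear_order_on (carrier G) r"
proof -
  interpret comm_group G by fact
  obtain L where lin: "linear_order_on (carrier G) L" and comp: "compatible_order G L"
    using torsion_free_compatible_linear_order[OF assms(2)] by blast
  have anti: "antisym L" and total: "total_on (carrier G) L" and tr: "trans L"
    using lin by (auto simp: linear_order_on_def partial_order_on_def preorder_on_def)
  have translate: "(z \<otimes>\<^bsub>G\<^esub> x, z \<otimes>\<^bsub>G\<^esub> y) \<in> L"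
    if "(x, y) \<in> L" "x \<in> carrier G" "y \<in> carrier G" "z \<in> carrier G" for x y z
    using comp that by (auto simp: compatible_order_def)
  obtain a where a: "a \<in> carrier G" "a \<noteq> \<one>\<^bsub>G\<^esub>"
    using assms(3) is_group by (auto simp: trivial_group_def)
  have "\<exists>e\<in>carrier G. e \<noteq> \<one>\<^bsub>G\<^esub> \<and> (\<one>\<^bsub>G\<^esub>, e) \<in> L"
  proof (cases "(\<one>\<^bsub>G\<^esub>, a) \<in> L")
    case True
    then show ?thesis using a by blast
  next
    case False
    then have "(a, \<one>\<^bsub>G\<^esub>) \<in> L" using total a by (auto simp: total_on_def)
    then have "(\<one>\<^bsub>G\<^esub>, inv\<^bsub>G\<^esub> a) \<in> L"
      using translate[of a "\<one>\<^bsub>G\<^esub>" "inv\<^bsub>G\<^esub> a"] a by simp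
    then show ?thesis using a by (intro bexI[of _ "inv\<^bsub>G\<^esub> a"]) auto
  qed
  then obtain e where e: "e \<in> carrier G" "e \<noteq> \<one>\<^bsub>G\<^esub>" "(\<one>\<^bsub>G\<^esub>, e) \<in> L" by blast
  \<comment> \<open>Squaring leaves room for \<open>e\<close> strictly between \<open>\<one>\<close> and \<open>c\<close>, also when no element lies between
    \<open>\<one>\<close> and \<open>e\<close>, as for the least positive integer.\<close>
  define c where "c = e \<otimes>\<^bsub>G\<^esub> e"
  have ec: "(e, c) \<in> L" using translate[OF e(3)] e by (auto simp: c_def)
  have "e \<noteq> c" using e by (simp add: c_def)
  have c: "(\<one>\<^bsub>G\<^esub>, c) \<in> L" using tr e(3) ec by (meson transD)
  have "c \<noteq> \<one>\<^bsub>G\<^esub>" using anti e ec by (auto simp: antisym_def)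
  note hyps = lin comp c this
  show ?thesis
    using shift_order_compatible[OF hyps] shift_order_threshold[OF hyps]
      shift_order_not_linear[OF hyps e(3) ec e(2) \<open>e \<noteq> c\<close>] by blast
qed

end
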